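(* Let $q>3$ and $k>t\ge 0$ be integers. Then there is $n_0=n_0(q,k,t)$ such that for all $n\ge n_0$, $\mathcal A_q(t,k,n)$ is, up to equivalence, the unique maximum size anticode of length $n$, constant weight $k$ and diameter $2(k-t)-1$ over $\mathbb Z_q$; that is, it has the maximum size among all $(n,2(k-t)-1,k)_q$ anticodes, and every $(n,2(k-t)-1,k)_q$ anticode of this maximum size is equivalent to $\mathcal A_q(t,k,n)$.
   Context: $\mathbb Z_q=\{0,1,\dots,q-1\}$ is the alphabet. The Hamming distance of two words of the same length over $\mathbb Z_q$ is the number of coordinates in which they differ; the weight $\mathrm{wt}(x)$ of a word $x$ is the number of its nonzero entries. An $(n,D,k)_q$ anticode is a set of words of length $n$ and weight $k$ over $\mathbb Z_q$ whose diameter (the maximum Hamming distance between two of its words) is $D$. $\mathcal A_q(t,k,n)$ is the set of all words of length $n$ over $\mathbb Z_q$ of the form $(1,\dots,1,a,b_1,\dots,b_{n-t-1})$, starting with $t$ ones, where $a\in\mathbb Z_q\setminus\{0\}$, $b_i\in\mathbb Z_q$ and $\mathrm{wt}(b_1,\dots,b_{n-t-1})=k-t-1$. Two sets of words of length $n$ and constant weight $k$ over $\mathbb Z_q$ are equivalent if one is obtained from the other by a permutation of the $n$ coordinates together with, in each coordinate separately, a permutation of the symbols of $\mathbb Z_q$ fixing $0$. *)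

theory Defs
  imports Main "HOL-Combinatorics.Permutations"
begin

definition words :: "nat \<Rightarrow> nat \<Rightarrow> nat list set" where
  "words q n = {x. length x = n \<and> set x \<subseteq> {..<q}}"

definition wt :: "nat list \<Rightarrow> nat" where
  "wt x = card {i. i < length x \<and> x ! i \<noteq> 0}"

text \<open>Meaningful only for words of the same length.\<close>
definition hamming_dist :: "nat list \<Rightarrow> nat list \<Rightarrow> nat" where
  "hamming_dist x y = card {i. i < length x \<and> x ! i \<noteq> y ! i}"

text \<open>Meaningful only for finite nonempty sets of words of the same length.\<close>
definition hamming_diameter :: "nat list set \<Rightarrow> nat" where
  "hamming_diameter A = Max {hamming_dist x y | x y. x \<in> A \<and> y \<in> A}"

text \<open>The diameter is exactly \<open>D\<close>; the empty set, which has no diameter, is excluded.\<close>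
definition anticode :: "nat \<Rightarrow> nat \<Rightarrow> nat \<Rightarrow> nat \<Rightarrow> nat list set \<Rightarrow> bool" where
  "anticode q n D k A \<longleftrightarrow>
     A \<subseteq> {x \<in> words q n. wt x = k} \<and> A \<noteq> {} \<and> hamming_diameter A = D"

text \<open>The lengths and weights are written as sums to avoid truncated subtraction.\<close>
definition A_family :: "nat \<Rightarrow> nat \<Rightarrow> nat \<Rightarrow> nat \<Rightarrow> nat list set" where
  "A_family q t k n =
     {replicate t 1 @ a # b | a b.
        a \<in> {..<q} - {0} \<and> set b \<subseteq> {..<q} \<and> t + 1 + length b = n \<and> t + 1 + wt b = k}"

definition equivalent :: "nat \<Rightarrow> nat \<Rightarrow> nat list set \<Rightarrow> nat list set \<Rightarrow> bool" where
  "equivalent q n A B \<longleftrightarrow>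
     (\<exists>\<pi> \<sigma>. \<pi> permutes {..<n} \<and> (\<forall>i<n. \<sigma> i permutes {..<q} \<and> \<sigma> i 0 = 0) \<and>
        B = (\<lambda>x. map (\<lambda>i. \<sigma> i (x ! \<pi> i)) [0..<n]) ` A)"

end

theory Submission
  imports Defs "HOL-Library.FuncSet"
begin

text \<open>
  For words \<open>x\<close>, \<open>y\<close> of weight \<open>k\<close> the distance is \<open>2 * k - c - a\<close>, where \<open>c\<close> is the number of common
  nonzero positions and \<open>a\<close> the number of those in which the entries agree
  (\<open>hamming_dist_add_overlap\<close>).  Diameter at most \<open>2 * (k - t) - 1\<close> therefore means
  \<open>c + a \<ge> 2 * t + 1\<close> for all pairs, and since \<open>a \<le> c\<close> the supports pairwise share at least \<open>t + 1\<close>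
  positions.  Now let \<open>n\<close> grow with \<open>q\<close>, \<open>k\<close>, \<open>t\<close> fixed.  The words with \<open>s\<close> prescribed nonzero entries
  number about \<open>n ^ (k - s)\<close> up to a constant, so a family in which every word has \<open>t + 2\<close> support points
  inside one set of bounded size is negligible against a family of order \<open>n ^ (k - t - 1)\<close>
  (\<open>card_concentrated_le\<close> and \<open>completion_count_dominates\<close>).

  This leaves little room.  If no \<open>t + 1\<close> positions lie in all supports, the family is concentrated in
  this sense (\<open>no_kernel_imp_small\<close>).  Otherwise let \<open>T\<close> be such a set of \<open>t + 1\<close> positions.  Two words
  that differ in two or more positions of \<open>T\<close> must have supports meeting outside \<open>T\<close> as well, for
  otherwise \<open>c + a \<le> (t + 1) + (t - 1)\<close>.  The words having such a partner are again concentrated, because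
  the behaviour on \<open>T\<close> is one of finitely many patterns.  The remaining words pairwise differ in at most
  one position of \<open>T\<close>, hence their patterns lie on a line: all positions of \<open>T\<close> but one, say \<open>i\<close>, are
  fixed.  As soon as one clash occurs, at most \<open>q - 2\<close> of the \<open>q - 1\<close> points of that line can be used
  without a partner (\<open>clashing_imp_small\<close>), which costs a term of the leading order.  So a family of maximum
  size has no clash at all and is contained in a full line family (\<open>overlapping_small_or_in_line\<close>).  The
  family \<open>A_family q t k n\<close> is itself the line family for \<open>T = {..t}\<close> and \<open>i = t\<close>, all full line families
  have the same size, and they are carried to one another by moving \<open>T\<close> to \<open>{..t}\<close> and relabelling the
  fixed entries to \<open>1\<close>.
\<close>

section \<open>Words of constant weight and their overlap\<close>

definition const_wt_words :: "nat \<Rightarrow> nat \<Rightarrow> nat \<Rightarrow> nat list set" where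
  "const_wt_words q n k = {x \<in> words q n. wt x = k}"

definition supp :: "nat list \<Rightarrow> nat set" where
  "supp x = {i. i < length x \<and> x ! i \<noteq> 0}"

definition agree :: "nat list \<Rightarrow> nat list \<Rightarrow> nat set" where
  "agree x y = {i \<in> supp x \<inter> supp y. x ! i = y ! i}"

text \<open>With \<open>i \<in> T\<close> this is a combinatorial line in the coordinates \<open>T\<close>, with only the letters of \<open>V\<close> admitted at the
  moving position \<open>i\<close>; the coordinates outside \<open>T\<close> are free apart from the weight.\<close>

definition line :: "nat \<Rightarrow> nat \<Rightarrow> nat \<Rightarrow> nat set \<Rightarrow> nat \<Rightarrow> (nat \<Rightarrow> nat) \<Rightarrow> nat set \<Rightarrow> nat list set" where
  "line q n k T i w V = {x \<in> const_wt_words q n k. (\<forall>j \<in> T - {i}. x ! j = w j) \<and> x ! i \<in> V}"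

text \<open>The number of words of weight \<open>k\<close> with \<open>s\<close> prescribed nonzero entries (see \<open>card_prescribed\<close>).  The case
  distinction matters: for \<open>s > k\<close> the truncated difference would turn the formula into \<open>1\<close>, although
  no such word exists.\<close>

definition completion_count :: "nat \<Rightarrow> nat \<Rightarrow> nat \<Rightarrow> nat \<Rightarrow> nat" where
  "completion_count q n k s = (if s \<le> k then ((n - s) choose (k - s)) * (q - 1) ^ (k - s) else 0)"

lemma finite_supp [simp]: "finite (supp x)"
  by (simp add: supp_def)

lemma const_wt_words_iff:
  "x \<in> const_wt_words q n k \<longleftrightarrow> length x = n \<and> (\<forall>i<n. x ! i < q) \<and> card (supp x) = k"
  by (auto simp: const_wt_words_def words_def wt_def supp_def set_conv_nth)

lemma supp_subset: "x \<in> const_wt_words q n k \<Longrightarrow> supp x \<subseteq> {..<n}"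
  by (auto simp: const_wt_words_iff supp_def)

lemma finite_const_wt_words [simp]: "finite (const_wt_words q n k)"
proof (rule finite_subset)
  show "const_wt_words q n k \<subseteq> {x. set x \<subseteq> {..<q} \<and> length x = n}"
    by (auto simp: const_wt_words_def words_def)
  show "finite {x. set x \<subseteq> {..<q} \<and> length x = n}"
    by (rule finite_lists_length_eq) simp
qed

lemma hamming_dist_add_overlap:
  assumes x: "x \<in> const_wt_words q n k" and y: "y \<in> const_wt_words q n k"
  shows "hamming_dist x y + card (supp x \<inter> supp y) + card (agree x y) = 2 * k"
proof -
  have "{i. i < length x \<and> x ! i \<noteq> y ! i} = (supp x \<union> supp y) - agree x y"
    using x y by (auto simp: const_wt_words_iff supp_def agree_def)
  moreover have "agree x y \<subseteq> supp x \<union> supp y" "finite (agree x y)"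
    by (auto simp: agree_def)
  ultimately have "hamming_dist x y + card (agree x y) = card (supp x \<union> supp y)"
    by (simp add: hamming_dist_def card_Diff_subset card_mono)
  moreover have "card (supp x \<union> supp y) + card (supp x \<inter> supp y) = k + k"
    using card_Un_Int[of "supp x" "supp y"] x y by (simp add: const_wt_words_iff)
  ultimately show ?thesis by linarith
qed

section \<open>Counting words with prescribed entries\<close>

lemma card_supersets:
  assumes "finite A" "T \<subseteq> A" "card T \<le> k"
  shows "card {K. T \<subseteq> K \<and> K \<subseteq> A \<and> card K = k} = (card A - card T) choose (k - card T)"
proof -
  have fT: "finite T" using assms finite_subset by blast
  have "{K. T \<subseteq> K \<and> K \<subseteq> A \<and> card K = k}
      = (\<lambda>L. T \<union> L) ` {L. L \<subseteq> A - T \<and> card L = k - card T}" (is "?X = _ ` ?Y")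
  proof (intro equalityI subsetI)
    fix K assume K: "K \<in> ?X"
    then have "card (K - T) = k - card T" using fT by (simp add: card_Diff_subset)
    then show "K \<in> (\<lambda>L. T \<union> L) ` ?Y" using K by (intro image_eqI[of _ _ "K - T"]) auto
  next
    fix K assume "K \<in> (\<lambda>L. T \<union> L) ` ?Y"
    then obtain L where L: "K = T \<union> L" "L \<subseteq> A - T" "card L = k - card T" by auto
    have "finite L" using L assms(1) finite_subset[of L "A - T"] by simp
    moreover have "T \<inter> L = {}" using L by blast
    ultimately have "card K = card T + card L" using L fT by (simp add: card_Un_disjoint)
    then show "K \<in> ?X" using L assms by auto
  qed
  moreover have "inj_on (\<lambda>L. T \<union> L) ?Y"
    by (rule inj_onI) blast
  ultimately have "card ?X = card ?Y" by (simp add: card_image)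
  also have "\<dots> = card (A - T) choose (k - card T)"
    using assms(1) by (intro n_subsets) simp
  finally show ?thesis using assms fT by (simp add: card_Diff_subset)
qed

text \<open>Sorted by their support \<open>K\<close>, which ranges over the \<open>k\<close>-sets containing \<open>T\<close>, these words are the
  functions choosing one of \<open>q - 1\<close> letters at each point of \<open>K - T\<close>.\<close>

lemma card_prescribed:
  assumes T: "T \<subseteq> {..<n}" and u: "\<And>i. i \<in> T \<Longrightarrow> u i \<in> {1..<q}" and q: "q > 0"
  shows "card {x \<in> const_wt_words q n k. \<forall>i\<in>T. x ! i = u i} = completion_count q n k (card T)"
proof (cases "card T \<le> k")
  case False
  have "x \<notin> const_wt_words q n k" if "\<forall>i\<in>T. x ! i = u i" for x
  proof
    assume x: "x \<in> const_wt_words q n k"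
    have "T \<subseteq> supp x" using that T u x by (fastforce simp: supp_def const_wt_words_iff)
    then have "card T \<le> card (supp x)" by (simp add: card_mono)
    then show False using False x by (simp add: const_wt_words_iff)
  qed
  then have "{x \<in> const_wt_words q n k. \<forall>i\<in>T. x ! i = u i} = {}" by blast
  then show ?thesis using False by (simp only: completion_count_def card.empty) simp
next
  case True
  have fT: "finite T" using T finite_subset by blast
  define Ks where "Ks = {K. T \<subseteq> K \<and> K \<subseteq> {..<n} \<and> card K = k}"
  \<comment> \<open>\<open>C K i\<close>: the letters possible at position \<open>i\<close> when the support is \<open>K\<close>\<close>
  define C where "C K i = (if i \<in> T then {u i} else if i \<in> K then {1..<q} else {0})" for K i
  define X where "X K = {x \<in> const_wt_words q n k. (\<forall>i\<in>T. x ! i = u i) \<and> supp x = K}" for K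
  have fin: "finite Ks" unfolding Ks_def by (rule finite_subset[of _ "Pow {..<n}"]) auto
  have cX: "card (X K) = (q - 1) ^ (k - card T)" if K: "K \<in> Ks" for K
  proof -
    have KT: "T \<subseteq> K" "K \<subseteq> {..<n}" "card K = k" "finite K"
      using K finite_subset by (auto simp: Ks_def)
    have "bij_betw (\<lambda>f. map f [0..<n]) (Pi\<^sub>E {..<n} (C K)) (X K)"
    proof (rule bij_betw_byWitness[where f' = "\<lambda>x. \<lambda>i\<in>{..<n}. x ! i"])
      show "\<forall>f\<in>Pi\<^sub>E {..<n} (C K). (\<lambda>i\<in>{..<n}. map f [0..<n] ! i) = f"
        by (auto simp: fun_eq_iff PiE_def extensional_def)
      show "\<forall>x\<in>X K. map (\<lambda>i\<in>{..<n}. x ! i) [0..<n] = x"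
        by (auto simp: X_def const_wt_words_iff intro!: nth_equalityI)
      show "(\<lambda>f. map f [0..<n]) ` Pi\<^sub>E {..<n} (C K) \<subseteq> X K"
      proof
        fix x assume "x \<in> (\<lambda>f. map f [0..<n]) ` Pi\<^sub>E {..<n} (C K)"
        then obtain f where f: "f \<in> Pi\<^sub>E {..<n} (C K)" "x = map f [0..<n]" by blast
        have fi: "x ! i \<in> C K i" if i: "i < n" for i
        proof -
          have "f i \<in> C K i" using f(1) i by (blast dest: PiE_mem)
          then show ?thesis using f(2) i by simp
        qed
        have "supp x = K"
        proof (intro set_eqI iffI)
          fix i assume "i \<in> supp x"
          then have "i < n" "x ! i \<noteq> 0" using f(2) by (auto simp: supp_def)
          then show "i \<in> K" using fi[of i] KT(1) by (auto simp: C_def split: if_splits)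
        next
          fix i assume "i \<in> K"
          then have "i < n" using KT by auto
          then have "x ! i \<noteq> 0" using fi[of i] u[of i] \<open>i \<in> K\<close>
            by (auto simp: C_def split: if_splits)
          then show "i \<in> supp x" using \<open>i < n\<close> f(2) by (simp add: supp_def)
        qed
        moreover have "\<forall>i<n. x ! i < q"
        proof (intro allI impI)
          fix i assume "i < n"
          then show "x ! i < q" using fi[of i] u[of i] q by (simp add: C_def split: if_splits)
        qed
        moreover have "\<forall>i\<in>T. x ! i = u i"
        proof
          fix i assume "i \<in> T"
          then show "x ! i = u i" using fi[of i] T by (auto simp: C_def)
        qed
        ultimately show "x \<in> X K"
          using KT(3) f(2) by (simp add: X_def const_wt_words_iff)
      qed
      show "(\<lambda>x. \<lambda>i\<in>{..<n}. x ! i) ` X K \<subseteq> Pi\<^sub>E {..<n} (C K)"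
        by (fastforce simp: X_def C_def const_wt_words_iff supp_def)
    qed
    then have "card (X K) = card (Pi\<^sub>E {..<n} (C K))"
      by (simp add: bij_betw_same_card)
    also have "\<dots> = (\<Prod>i<n. card (C K i))" by (simp add: card_PiE)
    also have "\<dots> = (\<Prod>i<n. if i \<in> K - T then q - 1 else 1)"
      by (rule prod.cong) (use KT in \<open>auto simp: C_def\<close>)
    also have "\<dots> = (\<Prod>i\<in>K - T. q - 1)"
      by (rule prod.mono_neutral_cong_right) (use KT in auto)
    also have "\<dots> = (q - 1) ^ (k - card T)"
      using KT fT by (simp add: card_Diff_subset)
    finally show ?thesis .
  qed
  have "{x \<in> const_wt_words q n k. \<forall>i\<in>T. x ! i = u i} = (\<Union>K\<in>Ks. X K)"
  proof (intro equalityI subsetI)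
    fix x assume x: "x \<in> {x \<in> const_wt_words q n k. \<forall>i\<in>T. x ! i = u i}"
    then have "T \<subseteq> supp x" using T u by (fastforce simp: supp_def const_wt_words_iff)
    then have "supp x \<in> Ks" using x supp_subset[of x] by (auto simp: Ks_def const_wt_words_iff)
    then show "x \<in> (\<Union>K\<in>Ks. X K)" using x by (auto simp: X_def)
  qed (auto simp: X_def)
  also have "card \<dots> = (\<Sum>K\<in>Ks. card (X K))"
    by (rule card_UN_disjoint) (use fin in \<open>auto simp: X_def\<close>)
  also have "\<dots> = card Ks * (q - 1) ^ (k - card T)" using cX by simp
  also have "card Ks = (n - card T) choose (k - card T)"
    unfolding Ks_def using card_supersets[of "{..<n}" T k] T True by simp
  finally show ?thesis using True by (simp add: completion_count_def)
qed

text \<open>In particular the size of a line family depends on \<open>T\<close> only through \<open>card T\<close>, and not on \<open>w\<close> and \<open>i\<close>,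
  so that all candidates for an optimal anticode have the same size.\<close>

lemma card_line:
  assumes T: "T \<subseteq> {..<n}" "i \<in> T" and w: "\<And>j. j \<in> T - {i} \<Longrightarrow> w j \<in> {1..<q}"
    and V: "V \<subseteq> {1..<q}" and q: "q > 0"
  shows "card (line q n k T i w V) = card V * completion_count q n k (card T)"
proof -
  have "line q n k T i w V = (\<Union>v\<in>V. {x \<in> const_wt_words q n k. \<forall>j\<in>T. x ! j = (w(i := v)) j})"
    using T by (auto simp: line_def)
  also have "card \<dots> = (\<Sum>v\<in>V. card {x \<in> const_wt_words q n k. \<forall>j\<in>T. x ! j = (w(i := v)) j})"
  proof (rule card_UN_disjoint)
    show "finite V" using V finite_subset by blast
    show "\<forall>v\<in>V. \<forall>v'\<in>V. v \<noteq> v' \<longrightarrow> {x \<in> const_wt_words q n k. \<forall>j\<in>T. x ! j = (w(i := v)) j}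
        \<inter> {x \<in> const_wt_words q n k. \<forall>j\<in>T. x ! j = (w(i := v')) j} = {}"
      using T by (auto split: if_splits)
  qed auto
  also have "\<dots> = (\<Sum>v\<in>V. completion_count q n k (card T))"
    by (rule sum.cong[OF refl], rule card_prescribed) (use T w V q in auto)
  finally show ?thesis by simp
qed

lemma card_star_le:
  assumes S: "S \<subseteq> {..<n}" and q: "q > 0"
  shows "card {x \<in> const_wt_words q n k. S \<subseteq> supp x} \<le> (q - 1) ^ card S * completion_count q n k (card S)"
proof -
  let ?P = "Pi\<^sub>E S (\<lambda>_. {1..<q})"
  have fS: "finite S" using S finite_subset by blast
  have "{x \<in> const_wt_words q n k. S \<subseteq> supp x} \<subseteq> (\<Union>u\<in>?P. {x \<in> const_wt_words q n k. \<forall>i\<in>S. x ! i = u i})"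
  proof
    fix x assume x: "x \<in> {x \<in> const_wt_words q n k. S \<subseteq> supp x}"
    then have "(\<lambda>i\<in>S. x ! i) \<in> ?P" by (fastforce simp: const_wt_words_iff supp_def)
    moreover have "\<forall>i\<in>S. x ! i = (\<lambda>i\<in>S. x ! i) i" by simp
    ultimately show "x \<in> (\<Union>u\<in>?P. {x \<in> const_wt_words q n k. \<forall>i\<in>S. x ! i = u i})"
      using x by blast
  qed
  then have "card {x \<in> const_wt_words q n k. S \<subseteq> supp x}
      \<le> card (\<Union>u\<in>?P. {x \<in> const_wt_words q n k. \<forall>i\<in>S. x ! i = u i})"
    by (rule card_mono[rotated]) (use fS in \<open>auto intro!: finite_PiE\<close>)
  also have "\<dots> \<le> (\<Sum>u\<in>?P. card {x \<in> const_wt_words q n k. \<forall>i\<in>S. x ! i = u i})"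
    by (rule card_UN_le) (use fS in \<open>auto intro!: finite_PiE\<close>)
  also have "\<dots> = (\<Sum>u\<in>?P. completion_count q n k (card S))"
    by (rule sum.cong[OF refl], rule card_prescribed) (use S q in auto)
  also have "\<dots> = (q - 1) ^ card S * completion_count q n k (card S)"
    using fS by (simp add: card_PiE)
  finally show ?thesis .
qed

text \<open>A family whose words all have \<open>s\<close> support points in a set \<open>M\<close> is covered by the stars of the
  \<open>s\<close>-subsets of \<open>M\<close>.  When \<open>m\<close> does not depend on \<open>n\<close>, the bound is a constant times
  \<open>completion_count q n k s\<close>.\<close>

lemma card_concentrated_le:
  assumes G: "G \<subseteq> const_wt_words q n k" and M: "M \<subseteq> {..<n}" "card M \<le> m" and q: "q > 0"
    and meet: "\<And>x. x \<in> G \<Longrightarrow> s \<le> card (supp x \<inter> M)"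
  shows "card G \<le> 2 ^ m * ((q - 1) ^ s * completion_count q n k s)"
proof -
  let ?Ss = "{S. S \<subseteq> M \<and> card S = s}"
  have fM: "finite M" using M finite_subset by blast
  have fin: "finite ?Ss" by (rule finite_subset[of _ "Pow M"]) (use fM in auto)
  have "G \<subseteq> (\<Union>S\<in>?Ss. {x \<in> const_wt_words q n k. S \<subseteq> supp x})"
  proof
    fix x assume x: "x \<in> G"
    obtain S where "S \<subseteq> supp x \<inter> M" "card S = s"
      using obtain_subset_with_card_n[OF meet[OF x]] by blast
    then show "x \<in> (\<Union>S\<in>?Ss. {x \<in> const_wt_words q n k. S \<subseteq> supp x})" using x G by auto
  qed
  then have "card G \<le> card (\<Union>S\<in>?Ss. {x \<in> const_wt_words q n k. S \<subseteq> supp x})"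
    by (rule card_mono[rotated]) (use fin in auto)
  also have "\<dots> \<le> (\<Sum>S\<in>?Ss. card {x \<in> const_wt_words q n k. S \<subseteq> supp x})"
    by (rule card_UN_le) (rule fin)
  also have "\<dots> \<le> (\<Sum>S\<in>?Ss. (q - 1) ^ s * completion_count q n k s)"
  proof (rule sum_mono)
    fix S assume "S \<in> ?Ss"
    then show "card {x \<in> const_wt_words q n k. S \<subseteq> supp x} \<le> (q - 1) ^ s * completion_count q n k s"
      using card_star_le[of S n q k] M q by auto
  qed
  also have "\<dots> = card ?Ss * ((q - 1) ^ s * completion_count q n k s)" by simp
  also have "\<dots> \<le> 2 ^ m * ((q - 1) ^ s * completion_count q n k s)"
  proof (rule mult_right_mono)
    have "card ?Ss \<le> card (Pow M)" by (rule card_mono) (use fM in auto)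
    also have "\<dots> = 2 ^ card M" using fM by (simp add: card_Pow)
    also have "\<dots> \<le> 2 ^ m" using M by (simp add: power_increasing)
    finally show "card ?Ss \<le> 2 ^ m" .
  qed simp
  finally show ?thesis .
qed

text \<open>The quotient of the two counts is \<open>(q - 1) * (n - s) / (k - s)\<close> when \<open>s < k\<close>, and it tends to infinity
  with \<open>n\<close>; for \<open>s = k\<close> the left-hand side is \<open>0\<close>.\<close>

lemma completion_count_dominates:
  assumes q: "q > 1" and s: "s \<le> k"
  shows "\<exists>n0. \<forall>n\<ge>n0. c * completion_count q n k (Suc s) < completion_count q n k s"
proof (cases "s = k")
  case True
  then show ?thesis by (simp add: completion_count_def)
next
  case False
  then obtain r where r: "k = Suc (s + r)" using s less_iff_Suc_add[of s k] by auto
  have "c * completion_count q n k (Suc s) < completion_count q n k s" if n: "n \<ge> Suc (s + r + c * Suc r)" for n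
  proof -
    define N where "N = n - Suc s"
    have N: "n = Suc (s + N)" "N \<ge> r" "N \<ge> c * Suc r"
      using n by (simp_all add: N_def)
    have pos: "0 < N choose r" using N by (simp add: zero_less_binomial)
    have "Suc r * (c * (N choose r)) \<le> N * (N choose r)"
      using mult_le_mono1[OF N(3), of "N choose r"] by (simp only: ac_simps)
    also have "\<dots> < Suc N * (N choose r)" using pos by simp
    also have "\<dots> = Suc r * (Suc N choose Suc r)"
      using Suc_times_binomial_eq[of N r] by (simp only: mult.commute)
    finally have "c * (N choose r) < Suc N choose Suc r"
      by (simp only: mult_less_cancel1)
    then have "c * (N choose r) * (q - 1) ^ r < (Suc N choose Suc r) * (q - 1) ^ r"
      using q by simp
    also have "\<dots> \<le> (Suc N choose Suc r) * (q - 1) ^ Suc r"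
      using q by (intro mult_left_mono power_increasing) auto
    finally show ?thesis using r N by (simp add: completion_count_def Suc_diff_le mult.assoc)
  qed
  then show ?thesis by blast
qed

section \<open>Families without a common kernel\<close>

text \<open>The form that the bound \<open>2 * (k - t) - 1\<close> on all distances takes by \<open>hamming_dist_add_overlap\<close>.\<close>

definition overlapping :: "nat \<Rightarrow> nat list set \<Rightarrow> bool" where
  "overlapping t B \<longleftrightarrow>
     (\<forall>x\<in>B. \<forall>y\<in>B. 2 * t + 1 \<le> card (supp x \<inter> supp y) + card (agree x y))"

lemma overlapping_common_supp:
  assumes "overlapping t B" "x \<in> B" "y \<in> B"
  shows "t + 1 \<le> card (supp x \<inter> supp y)"
proof -
  have "card (agree x y) \<le> card (supp x \<inter> supp y)"
    by (rule card_mono) (auto simp: agree_def)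
  then show ?thesis using assms unfolding overlapping_def by fastforce
qed

text \<open>Fix a word \<open>x0\<close>, and for each \<open>s\<close>-subset \<open>S\<close> of its support a word \<open>y S\<close> whose support misses a point
  of \<open>S\<close>.  The union \<open>M\<close> of these boundedly many supports meets every support in more than \<open>s\<close> points:
  if \<open>z\<close> shares with \<open>x0\<close> just a set \<open>S\<close> of \<open>s\<close> points, then the \<open>s\<close> or more points which it shares with
  \<open>y S\<close> cannot all lie in \<open>S\<close>.\<close>

lemma no_kernel_imp_small:
  assumes B: "B \<subseteq> const_wt_words q n k" and q: "q > 0"
    and int: "\<And>x y. x \<in> B \<Longrightarrow> y \<in> B \<Longrightarrow> s \<le> card (supp x \<inter> supp y)"
    and no: "\<nexists>T. T \<subseteq> {..<n} \<and> card T = s \<and> (\<forall>x\<in>B. T \<subseteq> supp x)"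
  shows "card B \<le> 2 ^ (k + 2 ^ k * k) * ((q - 1) ^ Suc s * completion_count q n k (Suc s))"
proof (cases "B = {}")
  case False
  then obtain x0 where x0: "x0 \<in> B" by blast
  let ?Ss = "{S. S \<subseteq> supp x0 \<and> card S = s}"
  have fin: "finite ?Ss" by (rule finite_subset[of _ "Pow (supp x0)"]) auto
  have "\<forall>S\<in>?Ss. \<exists>y. y \<in> B \<and> \<not> S \<subseteq> supp y"
  proof
    fix S assume S: "S \<in> ?Ss"
    then have "S \<subseteq> {..<n}" using supp_subset x0 B by blast
    then show "\<exists>y. y \<in> B \<and> \<not> S \<subseteq> supp y" using no S by blast
  qed
  then obtain y where y: "\<And>S. S \<in> ?Ss \<Longrightarrow> y S \<in> B" "\<And>S. S \<in> ?Ss \<Longrightarrow> \<not> S \<subseteq> supp (y S)"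
    by metis
  have k: "card (supp z) = k" if "z \<in> B" for z using that B by (auto simp: const_wt_words_iff)
  define M where "M = supp x0 \<union> (\<Union>S\<in>?Ss. supp (y S))"
  have "card (\<Union>S\<in>?Ss. supp (y S)) \<le> (\<Sum>S\<in>?Ss. card (supp (y S)))"
    by (rule card_UN_le) (rule fin)
  also have "\<dots> = card ?Ss * k" using y k by simp
  also have "\<dots> \<le> 2 ^ k * k"
  proof (rule mult_right_mono)
    have "card ?Ss \<le> card (Pow (supp x0))" by (rule card_mono) auto
    then show "card ?Ss \<le> 2 ^ k" using k[OF x0] by (simp add: card_Pow)
  qed simp
  finally have "card M \<le> k + 2 ^ k * k"
    using card_Un_le[of "supp x0" "\<Union>S\<in>?Ss. supp (y S)"] k[OF x0] unfolding M_def by linarith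
  moreover have "M \<subseteq> {..<n}"
  proof -
    have "supp z \<subseteq> {..<n}" if "z \<in> B" for z using that B supp_subset by (blast dest: subsetD)
    then show ?thesis using x0 y(1) unfolding M_def by (intro Un_least UN_least) simp_all
  qed
  moreover have "Suc s \<le> card (supp z \<inter> M)" if z: "z \<in> B" for z
  proof (rule ccontr)
    assume "\<not> Suc s \<le> card (supp z \<inter> M)"
    then have le: "card (supp z \<inter> M) \<le> s" by simp
    define S where "S = supp z \<inter> supp x0"
    have "S \<subseteq> supp z \<inter> M" by (auto simp: S_def M_def)
    then have eq: "S = supp z \<inter> M"
      using int[OF z x0] le by (intro card_seteq) (auto simp: S_def)
    have "card S = s" using int[OF z x0] le eq by (simp add: S_def)
    then have SS: "S \<in> ?Ss" by (auto simp: S_def)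
    have "supp z \<inter> supp (y S) \<subseteq> S" using eq SS by (auto simp: M_def)
    then have "supp z \<inter> supp (y S) = S"
      using int[OF z y(1)[OF SS]] \<open>card S = s\<close> by (intro card_seteq) (auto simp: S_def)
    then show False using y(2)[OF SS] by blast
  qed
  ultimately show ?thesis by (intro card_concentrated_le[OF B _ _ q]) auto
qed simp

section \<open>Families with a common kernel\<close>

definition clash :: "nat set \<Rightarrow> nat list \<Rightarrow> nat list \<Rightarrow> bool" where
  "clash T x y \<longleftrightarrow> (\<exists>i\<in>T. \<exists>j\<in>T. i \<noteq> j \<and> x ! i \<noteq> y ! i \<and> x ! j \<noteq> y ! j)"

text \<open>Three pairwise distinct words at mutual distance one on \<open>T\<close> all differ in the same position; otherwise
  two of them would differ in two positions.\<close>

lemma clash_free_imp_collinear: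
  assumes "T \<noteq> {}" and free: "\<forall>x\<in>P. \<forall>y\<in>P. \<not> clash T x y"
  shows "\<exists>i\<in>T. \<forall>x\<in>P. \<forall>y\<in>P. \<forall>j\<in>T - {i}. x ! j = y ! j"
proof (cases "\<exists>x\<in>P. \<exists>y\<in>P. \<exists>i\<in>T. x ! i \<noteq> y ! i")
  case True
  then obtain x y i where xy: "x \<in> P" "y \<in> P" "i \<in> T" "x ! i \<noteq> y ! i" by blast
  have "z ! j = x ! j" if z: "z \<in> P" and j: "j \<in> T" "j \<noteq> i" for z j
  proof (rule ccontr)
    assume ne: "z ! j \<noteq> x ! j"
    have "z ! i = x ! i" using free z xy(1,3) j ne unfolding clash_def by blast
    moreover have "x ! j = y ! j" using free xy j unfolding clash_def by blast
    ultimately have "clash T z y" using xy(3,4) j ne unfolding clash_def by force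
    then show False using free z xy(2) by blast
  qed
  then have "\<forall>z\<in>P. \<forall>z'\<in>P. \<forall>j\<in>T - {i}. z ! j = z' ! j" by simp
  then show ?thesis using xy(3) by (rule bexI)
next
  case False
  then show ?thesis using assms(1) by blast
qed

text \<open>If the supports met only in \<open>T\<close>, the overlap would be at most \<open>(t + 1) + (t - 1)\<close>.\<close>

lemma clash_imp_large_overlap:
  assumes ov: "overlapping t B" and xy: "x \<in> B" "y \<in> B"
    and T: "card T = t + 1" "T \<subseteq> supp x" "T \<subseteq> supp y" and cl: "clash T x y"
  shows "t + 2 \<le> card (supp x \<inter> supp y)"
proof (rule ccontr)
  assume "\<not> t + 2 \<le> card (supp x \<inter> supp y)"
  then have eq: "T = supp x \<inter> supp y" using T by (intro card_seteq) auto
  obtain i j where ij: "i \<in> T" "j \<in> T" "i \<noteq> j" "x ! i \<noteq> y ! i" "x ! j \<noteq> y ! j"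
    using cl unfolding clash_def by blast
  have fT: "finite T" using eq by simp
  have "card (agree x y) \<le> card (T - {i, j})"
    using ij eq fT by (intro card_mono) (auto simp: agree_def)
  also have "\<dots> = card T - 2" using ij fT by (simp add: card_Diff_subset)
  finally have "card (agree x y) \<le> t - 1" using T by simp
  moreover have "2 \<le> card T" using card_mono[of T "{i, j}"] ij fT by simp
  moreover have "2 * t + 1 \<le> card (supp x \<inter> supp y) + card (agree x y)"
    using ov xy unfolding overlapping_def by blast
  ultimately show False using eq T by simp
qed

text \<open>The words without a clashing partner lie on a line.  They cannot use all its \<open>q - 1\<close> points: then every
  word \<open>y\<close> of the family would agree with the line outside position \<open>i\<close>, since some
  word on the line differs from \<open>y\<close> at \<open>i\<close> and must not clash with it; so nothing would clash.  This
  accounts for the first summand.  For the second, whether two words clash depends only on their restrictions to \<open>T\<close>, so boundedly many words \<open>y\<close> suffice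
  as partners, and their supports form the set in which the clashing words are concentrated.\<close>

lemma clashing_imp_small:
  assumes B: "B \<subseteq> const_wt_words q n k" and q: "q > 2" and ov: "overlapping t B"
    and T: "T \<subseteq> {..<n}" "card T = t + 1" "\<And>x. x \<in> B \<Longrightarrow> T \<subseteq> supp x"
    and xy: "x0 \<in> B" "y0 \<in> B" "clash T x0 y0"
  shows "card B \<le> (q - 2) * completion_count q n k (t + 1)
      + 2 ^ (q ^ (t + 1) * k) * ((q - 1) ^ (t + 2) * completion_count q n k (t + 2))"
proof -
  define B1 where "B1 = {x \<in> B. \<forall>y\<in>B. \<not> clash T x y}"
  define B2 where "B2 = {x \<in> B. \<exists>y\<in>B. clash T x y}"
  have fT: "finite T" using T finite_subset by blast
  have fB: "finite B" using B finite_subset finite_const_wt_words by blast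
  have ent: "x ! j \<in> {1..<q}" if "x \<in> B" "j \<in> T" for x j
    using T(3)[OF that(1)] B that by (fastforce simp: supp_def const_wt_words_iff)
  have "card B1 \<le> (q - 2) * completion_count q n k (t + 1)"
  proof (cases "B1 = {}")
    case False
    then obtain w where w: "w \<in> B1" by blast
    have "T \<noteq> {}" using T by auto
    moreover have "\<forall>x\<in>B1. \<forall>y\<in>B1. \<not> clash T x y" by (simp add: B1_def)
    ultimately obtain i where i: "i \<in> T" "\<forall>x\<in>B1. \<forall>y\<in>B1. \<forall>j\<in>T - {i}. x ! j = y ! j"
      using clash_free_imp_collinear[of T B1] by metis
    define V where "V = (\<lambda>x. x ! i) ` B1"
    have V: "V \<subseteq> {1..<q}" using ent i by (auto simp: V_def B1_def)
    have "V \<noteq> {1..<q}"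
    proof
      assume full: "V = {1..<q}"
      have col: "y ! j = w ! j" if y: "y \<in> B" and j: "j \<in> T - {i}" for y j
      proof (rule ccontr)
        assume ne: "y ! j \<noteq> w ! j"
        \<comment> \<open>a nonzero letter other than \<open>y ! i\<close>, which exists because \<open>q > 2\<close>\<close>
        define v where "v = (if y ! i = 1 then 2 else 1 :: nat)"
        have v: "v \<in> V" "v \<noteq> y ! i" using q full by (simp_all add: v_def)
        then obtain x where x: "x \<in> B1" "v = x ! i" unfolding V_def by blast
        have "x ! j = w ! j" using i(2) x(1) w j by blast
        then have "clash T x y" using i(1) ne j v(2) x(2) unfolding clash_def by force
        then show False using x(1) y by (simp add: B1_def)
      qed
      obtain a b where ab: "a \<in> T" "b \<in> T" "a \<noteq> b" "x0 ! a \<noteq> y0 ! a" "x0 ! b \<noteq> y0 ! b"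
        using xy(3) unfolding clash_def by blast
      have "a = i" using ab(1,4) col[OF xy(1), of a] col[OF xy(2), of a] by (cases "a = i") simp_all
      moreover have "b = i" using ab(2,5) col[OF xy(1), of b] col[OF xy(2), of b] by (cases "b = i") simp_all
      ultimately show False using ab(3) by simp
    qed
    then have "card V < card {1..<q}" using V by (intro psubset_card_mono) auto
    then have cV: "card V \<le> q - 2" by simp
    have "B1 \<subseteq> line q n k T i ((!) w) V"
      using B i(2) w unfolding line_def V_def B1_def by blast
    moreover have "finite (line q n k T i ((!) w) V)"
      by (rule finite_subset[OF _ finite_const_wt_words]) (auto simp: line_def)
    ultimately have "card B1 \<le> card (line q n k T i ((!) w) V)" by (simp add: card_mono)
    also have "\<dots> = card V * completion_count q n k (t + 1)"
    proof -
      have "w ! j \<in> {1..<q}" if "j \<in> T - {i}" for j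
        using ent[of w j] w that by (simp add: B1_def)
      then show ?thesis
        using card_line[OF T(1) i(1) _ V, of "(!) w" k] q T(2) by simp
    qed
    also have "\<dots> \<le> (q - 2) * completion_count q n k (t + 1)" using cV by simp
    finally show ?thesis .
  qed simp
  moreover have "card B2 \<le> 2 ^ (q ^ (t + 1) * k) * ((q - 1) ^ (t + 2) * completion_count q n k (t + 2))"
  proof -
    let ?r = "\<lambda>x. \<lambda>i\<in>T. x ! i"
    \<comment> \<open>one representative for each pattern on \<open>T\<close>\<close>
    obtain R where R: "R \<subseteq> B" "inj_on ?r R" "?r ` B = ?r ` R"
      using subset_image_inj[of "?r ` B" ?r B] by blast
    have "?r ` R \<subseteq> Pi\<^sub>E T (\<lambda>_. {..<q})"
    proof
      fix f assume "f \<in> ?r ` R"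
      then obtain x where "x \<in> B" "f = ?r x" using R by blast
      then show "f \<in> Pi\<^sub>E T (\<lambda>_. {..<q})" using ent by auto
    qed
    then have "card (?r ` R) \<le> card (Pi\<^sub>E T (\<lambda>_. {..<q}))"
      using fT by (intro card_mono finite_PiE) auto
    then have cR: "card R \<le> q ^ (t + 1)"
      using R(2) fT T(2) by (simp add: card_image card_PiE)
    define M where "M = (\<Union>y\<in>R. supp y)"
    have "card M \<le> (\<Sum>y\<in>R. card (supp y))"
      unfolding M_def by (rule card_UN_le) (use R fB finite_subset in blast)
    also have "\<dots> = (\<Sum>y\<in>R. k)"
      by (rule sum.cong) (use R B in \<open>auto simp: const_wt_words_iff\<close>)
    also have "\<dots> \<le> q ^ (t + 1) * k" using cR by simp
    finally have "card M \<le> q ^ (t + 1) * k" .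
    moreover have "M \<subseteq> {..<n}" using supp_subset R B unfolding M_def by blast
    moreover have "t + 2 \<le> card (supp x \<inter> M)" if x: "x \<in> B2" for x
    proof -
      obtain y where y: "y \<in> B" "clash T x y" using x by (auto simp: B2_def)
      obtain z where z: "z \<in> R" "?r y = ?r z" using y R by blast
      have "y ! j = z ! j" if "j \<in> T" for j using fun_cong[OF z(2), of j] that by simp
      then have "clash T x z" using y(2) unfolding clash_def by simp
      have "t + 2 \<le> card (supp x \<inter> supp z)"
      proof -
        have "x \<in> B" "z \<in> B" using x z(1) R(1) by (auto simp: B2_def)
        then show ?thesis
          using clash_imp_large_overlap[OF ov _ _ T(2) T(3) T(3)] \<open>clash T x z\<close> by blast
      qed
      also have "\<dots> \<le> card (supp x \<inter> M)" using z by (intro card_mono) (auto simp: M_def)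
      finally show ?thesis .
    qed
    ultimately show ?thesis
      using B q by (intro card_concentrated_le) (auto simp: B2_def)
  qed
  moreover have "card B \<le> card B1 + card B2"
  proof -
    have "B = B1 \<union> B2" by (auto simp: B1_def B2_def)
    then show ?thesis using card_Un_le by metis
  qed
  ultimately show ?thesis by linarith
qed

text \<open>The constants \<open>c1\<close> and \<open>c2\<close> bound the concentrated parts in the two cases where the family is not
  contained in a line family; the threshold on \<open>n\<close> makes both together smaller than the contribution
  of a single point of a line.\<close>

lemma overlapping_small_or_in_line:
  assumes q: "q > 2" and k: "t < k"
  shows "\<exists>n0. \<forall>n\<ge>n0. \<forall>B. B \<subseteq> const_wt_words q n k \<and> overlapping t B \<longrightarrow>
    card B < (q - 1) * completion_count q n k (t + 1) \<or>
    (\<exists>T i w. T \<subseteq> {..<n} \<and> card T = t + 1 \<and> i \<in> T \<and> (\<forall>j\<in>T - {i}. w j \<in> {1..<q}) \<and>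
       B \<subseteq> line q n k T i w {1..<q})"
proof -
  define c1 :: nat where "c1 = 2 ^ (k + 2 ^ k * k) * (q - 1) ^ (t + 2)"
  define c2 :: nat where "c2 = 2 ^ (q ^ (t + 1) * k) * (q - 1) ^ (t + 2)"
  obtain n0 where n0: "\<And>n. n \<ge> n0 \<Longrightarrow>
      (c1 + c2) * completion_count q n k (t + 2) < completion_count q n k (t + 1)"
    using completion_count_dominates[of q "t + 1" k "c1 + c2"] q k by auto
  show ?thesis
  proof (intro exI allI impI)
    fix n B assume n: "n \<ge> n0" and "B \<subseteq> const_wt_words q n k \<and> overlapping t B"
    then have B: "B \<subseteq> const_wt_words q n k" and ov: "overlapping t B" by auto
    let ?g = "completion_count q n k (t + 1)" and ?h = "completion_count q n k (t + 2)"
    have dom: "c1 * ?h + c2 * ?h < ?g" using n0[OF n] by (simp add: distrib_right)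
    have q1: "(q - 1) * ?g = (q - 2) * ?g + ?g"
    proof -
      have "q - 1 = Suc (q - 2)" using q by simp
      then show ?thesis by simp
    qed
    show "card B < (q - 1) * ?g \<or>
      (\<exists>T i w. T \<subseteq> {..<n} \<and> card T = t + 1 \<and> i \<in> T \<and> (\<forall>j\<in>T - {i}. w j \<in> {1..<q}) \<and>
         B \<subseteq> line q n k T i w {1..<q})"
    proof (cases "\<exists>T. T \<subseteq> {..<n} \<and> card T = t + 1 \<and> (\<forall>x\<in>B. T \<subseteq> supp x)")
      case False
      have "card B \<le> c1 * ?h"
        using no_kernel_imp_small[OF B _ overlapping_common_supp[OF ov] False] q
        by (simp add: c1_def mult.assoc)
      then show ?thesis using dom q1 by linarith
    next
      case True
      then obtain T where T: "T \<subseteq> {..<n}" "card T = t + 1" "\<forall>x\<in>B. T \<subseteq> supp x"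
        by (elim exE conjE)
      show ?thesis
      proof (cases "\<exists>x\<in>B. \<exists>y\<in>B. clash T x y")
        case True
        then obtain x y where xy: "x \<in> B" "y \<in> B" "clash T x y" by blast
        have "card B \<le> (q - 2) * ?g + c2 * ?h"
          using clashing_imp_small[OF B q ov T(1,2) _ xy] T(3)
          by (simp add: c2_def mult.assoc)
        then show ?thesis using dom q1 by linarith
      next
        case free: False
        show ?thesis
        proof (cases "B = {}")
          case True
          then have "card B < (q - 1) * ?g" using dom q1 by simp
          then show ?thesis ..
        next
          case False
          then obtain w where w: "w \<in> B" by blast
          have ent: "x ! j \<in> {1..<q}" if "x \<in> B" "j \<in> T" for x j
            using T(3) B that by (fastforce simp: supp_def const_wt_words_iff)
          have "T \<noteq> {}" using T(2) by auto
          moreover have "\<forall>x\<in>B. \<forall>y\<in>B. \<not> clash T x y" using free by simp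
          ultimately obtain i where i: "i \<in> T" "\<forall>x\<in>B. \<forall>y\<in>B. \<forall>j\<in>T - {i}. x ! j = y ! j"
            using clash_free_imp_collinear[of T B] by metis
          have "B \<subseteq> line q n k T i ((!) w) {1..<q}"
            unfolding line_def using B i(2) w ent[OF _ i(1)] by blast
          then have "T \<subseteq> {..<n} \<and> card T = t + 1 \<and> i \<in> T \<and> (\<forall>j\<in>T - {i}. w ! j \<in> {1..<q}) \<and>
            B \<subseteq> line q n k T i ((!) w) {1..<q}"
            using T(1,2) i(1) ent[OF w] by simp
          then show ?thesis by (intro disjI2 exI)
        qed
      qed
    qed
  qed
qed

section \<open>The optimal family and its equivalents\<close>

lemma wt_conv_filter: "wt x = length (filter (\<lambda>a. a \<noteq> 0) x)"
  by (simp add: wt_def length_filter_conv_card)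

lemma A_family_eq_line:
  assumes "t < n" "t < k" "q > 1"
  shows "A_family q t k n = line q n k {..t} t (\<lambda>_. 1) {1..<q}"
proof (intro equalityI subsetI)
  fix x assume "x \<in> A_family q t k n"
  then obtain a b where x: "x = replicate t 1 @ a # b" "a \<in> {..<q} - {0}" "set b \<subseteq> {..<q}"
     "t + 1 + length b = n" "t + 1 + wt b = k"
    unfolding A_family_def by blast
  have "wt x = k" using x(2,5) unfolding x(1) by (simp add: wt_conv_filter)
  moreover have "length x = n" using x(4) unfolding x(1) by simp
  moreover have "set x \<subseteq> {..<q}" using x(2,3) assms(3) unfolding x(1) by auto
  moreover have "\<forall>j\<in>{..t} - {t}. x ! j = 1" unfolding x(1) by (auto simp: nth_append)
  moreover have "x ! t \<in> {1..<q}" using x(2) unfolding x(1) by (simp add: nth_append)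
  ultimately show "x \<in> line q n k {..t} t (\<lambda>_. 1) {1..<q}"
    by (simp add: line_def const_wt_words_def words_def)
next
  fix x assume x: "x \<in> line q n k {..t} t (\<lambda>_. 1) {1..<q}"
  then have len: "length x = n" and sub: "set x \<subseteq> {..<q}" and wt: "wt x = k"
    and ones: "\<And>j. j < t \<Longrightarrow> x ! j = 1" and xt: "x ! t \<in> {1..<q}"
    by (simp_all add: line_def const_wt_words_def words_def)
  define b where "b = drop (Suc t) x"
  have "take t x = replicate t 1"
    using ones len assms(1) by (intro nth_equalityI) simp_all
  then have eq: "x = replicate t 1 @ x ! t # b"
    using id_take_nth_drop[of t x] len assms(1) by (simp add: b_def)
  have "wt x = t + 1 + wt b"
    by (subst eq) (use xt in \<open>simp add: wt_conv_filter\<close>)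
  moreover have "set b \<subseteq> {..<q}" using sub set_drop_subset[of "Suc t" x] by (auto simp: b_def)
  moreover have "t + 1 + length b = n" using len assms(1) by (simp add: b_def)
  moreover have "x ! t \<in> {..<q} - {0}" using xt by auto
  ultimately have "x = replicate t 1 @ x ! t # b \<and> x ! t \<in> {..<q} - {0} \<and>
      set b \<subseteq> {..<q} \<and> t + 1 + length b = n \<and> t + 1 + wt b = k"
    using eq wt by linarith
  then show "x \<in> A_family q t k n"
    unfolding A_family_def by (intro CollectI exI)
qed

lemma card_A_family:
  assumes "t < n" "t < k" "q > 1"
  shows "card (A_family q t k n) = (q - 1) * completion_count q n k (t + 1)"
proof -
  have "card (line q n k {..t} t (\<lambda>_. 1) {1..<q}) = card {1..<q} * completion_count q n k (card {..t})"
    by (rule card_line) (use assms in auto)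
  then show ?thesis using assms by (simp add: A_family_eq_line)
qed

text \<open>The coordinate permutation \<open>\<pi>\<close> takes \<open>{..<t}\<close> to \<open>T - {i}\<close> and \<open>t\<close> to \<open>i\<close>, and in the fixed positions
  the letter prescribed by \<open>w\<close> is swapped with \<open>1\<close>.  It is enough to see that the relabelling maps one family injectively
  into the other, because they have the same size.\<close>

lemma line_equivalent_A_family:
  assumes T: "T \<subseteq> {..<n}" "card T = t + 1" "i \<in> T"
    and w: "\<And>j. j \<in> T - {i} \<Longrightarrow> w j \<in> {1..<q}" and q: "q > 1" and k: "t < k"
  shows "equivalent q n (line q n k T i w {1..<q}) (A_family q t k n)"
proof -
  have fT: "finite T" using T finite_subset by blast
  have tn: "t < n" using card_mono[OF _ T(1)] T(2) by simp
  obtain h1 where h1: "bij_betw h1 {..<t} (T - {i})"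
    using finite_same_card_bij[of "{..<t}" "T - {i}"] T fT by auto
  obtain h2 where h2: "bij_betw h2 {t<..<n} ({..<n} - T)"
    using finite_same_card_bij[of "{t<..<n}" "{..<n} - T"] T fT by (auto simp: card_Diff_subset)
  define \<pi> where "\<pi> j = (if j < t then h1 j else if j = t then i else if j < n then h2 j else j)" for j
  have b1: "bij_betw \<pi> {..<t} (T - {i})"
    using h1 by (subst bij_betw_cong[of _ _ h1]) (simp_all add: \<pi>_def)
  have b2: "bij_betw \<pi> {t} {i}" by (simp add: \<pi>_def bij_betw_def)
  have b3: "bij_betw \<pi> {t<..<n} ({..<n} - T)"
    using h2 by (subst bij_betw_cong[of _ _ h2]) (simp_all add: \<pi>_def)
  have "bij_betw \<pi> ({..<t} \<union> {t} \<union> {t<..<n}) ((T - {i}) \<union> {i} \<union> ({..<n} - T))"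
    using T(3) by (intro bij_betw_combine b1 b2 b3) auto
  moreover have "{..<t} \<union> {t} \<union> {t<..<n} = {..<n}" using tn by auto
  moreover have "(T - {i}) \<union> {i} \<union> ({..<n} - T) = {..<n}" using T by auto
  ultimately have b: "bij_betw \<pi> {..<n} {..<n}" by simp
  then have perm: "\<pi> permutes {..<n}"
    by (rule bij_imp_permutes) (use tn in \<open>simp add: \<pi>_def\<close>)
  have \<pi>T: "\<pi> j \<in> T - {i}" if "j < t" for j using bij_betwE[OF b1] that by blast
  have \<pi>n: "\<pi> j < n" if "j < n" for j using bij_betwE[OF b] that by blast
  define \<sigma> where "\<sigma> j = (if j < t then Transposition.transpose 1 (w (\<pi> j)) else id)" for j
  have \<sigma>: "\<sigma> j permutes {..<q}" "\<sigma> j 0 = 0" for j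
    using w[OF \<pi>T, of j] q
    by (auto simp: \<sigma>_def permutes_id transpose_def intro!: permutes_swap_id)
  have inj: "\<sigma> j a = \<sigma> j b \<longleftrightarrow> a = b" for j a b
    using permutes_inj[OF \<sigma>(1)] by (simp add: inj_eq)
  have zero: "\<sigma> j a = 0 \<longleftrightarrow> a = 0" for j a using inj[of j a 0] \<sigma>(2) by simp
  have less: "\<sigma> j a < q" if "a < q" for j a
    using permutes_in_image[OF \<sigma>(1), of j a] that by simp
  define f where "f x = map (\<lambda>j. \<sigma> j (x ! \<pi> j)) [0..<n]" for x
  let ?L = "line q n k T i w {1..<q}" and ?A = "line q n k {..t} t (\<lambda>_. 1) {1..<q}"
  have "f ` ?L \<subseteq> ?A"
  proof
    fix y assume "y \<in> f ` ?L"
    then obtain x where x: "y = f x" "x \<in> ?L" by blast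
    then have c: "x \<in> const_wt_words q n k" "\<And>j. j \<in> T - {i} \<Longrightarrow> x ! j = w j" "x ! i \<in> {1..<q}"
      by (auto simp: line_def)
    have nth: "y ! j = \<sigma> j (x ! \<pi> j)" if "j < n" for j using that x(1) by (simp add: f_def)
    have "\<pi> ` supp y = supp x"
    proof (intro equalityI subsetI)
      fix a assume "a \<in> \<pi> ` supp y"
      then obtain j where "j < n" "y ! j \<noteq> 0" "a = \<pi> j"
        using x(1) by (auto simp: supp_def f_def)
      then show "a \<in> supp x" using nth zero \<pi>n c(1) by (simp add: supp_def const_wt_words_iff)
    next
      fix a assume "a \<in> supp x"
      then have a: "a < n" "x ! a \<noteq> 0" using c(1) by (auto simp: supp_def const_wt_words_iff)
      then obtain j where j: "j < n" "a = \<pi> j"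
        using bij_betw_imp_surj_on[OF b] by (metis imageE lessThan_iff)
      have "y ! j \<noteq> 0" using a(2) j(2) nth[OF j(1)] zero[of j "x ! \<pi> j"] by simp
      then have "j \<in> supp y" using j(1) x(1) by (simp add: supp_def f_def)
      then show "a \<in> \<pi> ` supp y" using j by blast
    qed
    moreover have "inj_on \<pi> (supp y)"
      using permutes_inj[OF perm] inj_on_subset by blast
    ultimately have "card (supp y) = k"
      using c(1) card_image[of \<pi> "supp y"] by (simp add: const_wt_words_iff)
    then have "y \<in> const_wt_words q n k"
      using x(1) nth less \<pi>n c(1) by (simp add: const_wt_words_iff f_def)
    moreover have "y ! j = 1" if "j < t" for j
      using nth[of j] c(2)[OF \<pi>T[OF that]] that tn by (simp add: \<sigma>_def)
    moreover have "y ! t \<in> {1..<q}"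
      using nth[OF tn] c(3) by (simp add: \<sigma>_def \<pi>_def)
    ultimately show "y \<in> ?A" by (auto simp: line_def)
  qed
  moreover have "inj_on f ?L"
  proof (rule inj_onI)
    fix x y assume xy: "x \<in> ?L" "y \<in> ?L" "f x = f y"
    then have len: "length x = n" "length y = n" by (auto simp: line_def const_wt_words_iff)
    have "x ! a = y ! a" if a: "a < n" for a
    proof -
      from a obtain j where j: "j < n" "a = \<pi> j"
        using bij_betw_imp_surj_on[OF b] by (metis imageE lessThan_iff)
      have "f x ! j = f y ! j" using xy(3) by simp
      then show ?thesis using j inj by (simp add: f_def)
    qed
    then show "x = y" using len by (simp add: nth_equalityI)
  qed
  moreover have "card ?L = card ?A"
    using card_line[OF T(1,3) w, where V = "{1..<q}" and k = k] card_A_family[OF tn k q] T(2) q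
    unfolding A_family_eq_line[OF tn k q] by simp
  moreover have "finite ?A"
    by (rule finite_subset[OF _ finite_const_wt_words]) (auto simp: line_def)
  ultimately have "f ` ?L = ?A" by (intro card_subset_eq) (simp_all add: card_image)
  then have "A_family q t k n = (\<lambda>x. map (\<lambda>j. \<sigma> j (x ! \<pi> j)) [0..<n]) ` ?L"
    using A_family_eq_line[OF tn k q] unfolding f_def by simp
  then show ?thesis unfolding equivalent_def using perm \<sigma> by blast
qed

lemma finite_hamming_dists:
  "finite A \<Longrightarrow> finite {hamming_dist x y | x y. x \<in> A \<and> y \<in> A}"
  by (rule finite_subset[of _ "(\<lambda>(x, y). hamming_dist x y) ` (A \<times> A)"]) auto

lemma anticode_imp_overlapping:
  assumes B: "anticode q n (2 * (k - t) - 1) k B" and k: "t < k"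
  shows "B \<subseteq> const_wt_words q n k" "overlapping t B"
proof -
  show sub: "B \<subseteq> const_wt_words q n k" using B by (simp add: anticode_def const_wt_words_def)
  then have fin: "finite B" by (rule finite_subset) simp
  show "overlapping t B"
    unfolding overlapping_def
  proof (intro ballI)
    fix x y assume xy: "x \<in> B" "y \<in> B"
    then have "hamming_dist x y \<le> hamming_diameter B"
      unfolding hamming_diameter_def by (intro Max_ge finite_hamming_dists fin) blast
    also have "\<dots> = 2 * (k - t) - 1" using B by (simp add: anticode_def)
    finally show "2 * t + 1 \<le> card (supp x \<inter> supp y) + card (agree x y)"
      using hamming_dist_add_overlap[OF subsetD[OF sub xy(1)] subsetD[OF sub xy(2)]] k
      by linarith
  qed
qed

text \<open>The distance \<open>2 * (k - t) - 1\<close> is attained by two words that differ in position \<open>t\<close> and whose remaining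
  \<open>r = k - t - 1\<close> nonzero entries occupy disjoint sets of positions; this is where \<open>n\<close> must be large and
  two different nonzero letters are needed.\<close>

lemma anticode_A_family:
  assumes q: "q > 2" and k: "t < k" and n: "n \<ge> t + 1 + 2 * (k - t - 1)"
  shows "anticode q n (2 * (k - t) - 1) k (A_family q t k n)"
proof -
  let ?A = "line q n k {..t} t (\<lambda>_. 1) {1..<q}"
  define r where "r = k - t - 1"
  have kr: "k = t + 1 + r" using k by (simp add: r_def)
  have tn: "t < n" using n by simp
  have q1: "q > 1" using q by simp
  have sub: "?A \<subseteq> const_wt_words q n k" by (auto simp: line_def)
  have fin: "finite ?A" by (rule finite_subset[OF sub]) simp
  have le: "hamming_dist x y \<le> 2 * (k - t) - 1" if x: "x \<in> ?A" and y: "y \<in> ?A" for x y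
  proof -
    have nz: "x ! j \<noteq> 0 \<and> y ! j \<noteq> 0" if "j \<le> t" for j
      using x y that by (cases "j = t") (simp_all add: line_def)
    have len: "length x = n" "length y = n" using x y by (simp_all add: line_def const_wt_words_iff)
    have "{..t} \<subseteq> supp x \<inter> supp y" using nz len tn by (auto simp: supp_def)
    then have "t + 1 \<le> card (supp x \<inter> supp y)" using card_mono[of _ "{..t}"] by fastforce
    moreover have "{..<t} \<subseteq> agree x y"
      using nz len tn x y by (auto simp: agree_def supp_def line_def)
    then have "t \<le> card (agree x y)" using card_mono[of "agree x y" "{..<t}"] by (simp add: agree_def)
    ultimately show ?thesis
      using hamming_dist_add_overlap[OF subsetD[OF sub x] subsetD[OF sub y]] by linarith
  qed
  define x where "x = map (\<lambda>j. if j < t + 1 + r then 1 else 0 :: nat) [0..<n]"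
  define y where "y = map (\<lambda>j. if j < t then 1 else if j = t then 2
    else if t + 1 + r \<le> j \<and> j < t + 1 + 2 * r then 1 else 0 :: nat) [0..<n]"
  have nr: "t + 1 + 2 * r \<le> n" using n by (simp add: r_def)
  have lx: "length x = n" "length y = n" by (simp_all add: x_def y_def)
  have xj: "x ! j = (if j < t + 1 + r then 1 else 0)" if "j < n" for j
    using that by (simp add: x_def)
  have yj: "y ! j = (if j < t then 1 else if j = t then 2
    else if t + 1 + r \<le> j \<and> j < t + 1 + 2 * r then 1 else 0)" if "j < n" for j
    using that by (simp add: y_def)
  have "supp x = {..<t + 1 + r}"
    using nr lx(1) by (auto simp: supp_def xj split: if_splits)
  then have cx: "card (supp x) = k" using kr by simp
  have "supp y = {..t} \<union> {t + 1 + r..<t + 1 + 2 * r}"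
    using nr lx(2) by (auto simp: supp_def yj split: if_splits)
  moreover have "card ({..t} \<union> {t + 1 + r..<t + 1 + 2 * r}) = t + 1 + r"
    by (subst card_Un_disjoint) auto
  ultimately have cy: "card (supp y) = k" using kr by simp
  have xA: "x \<in> ?A" using q tn cx lx(1) by (simp add: line_def const_wt_words_iff xj)
  moreover have "y \<in> ?A" using q tn cy lx(2) by (simp add: line_def const_wt_words_iff yj)
  moreover have "hamming_dist x y = 2 * (k - t) - 1"
  proof -
    have "{j. j < length x \<and> x ! j \<noteq> y ! j} = {t..<t + 1 + 2 * r}"
      using nr lx(1) by (auto simp: xj yj split: if_splits)
    then show ?thesis using kr by (simp add: hamming_dist_def)
  qed
  ultimately have att: "2 * (k - t) - 1 \<in> {hamming_dist x y | x y. x \<in> ?A \<and> y \<in> ?A}"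
    by (metis (mono_tags, lifting) CollectI)
  have "hamming_diameter ?A = 2 * (k - t) - 1"
    unfolding hamming_diameter_def
  proof (rule Max_eqI)
    show "d \<le> 2 * (k - t) - 1" if "d \<in> {hamming_dist x y | x y. x \<in> ?A \<and> y \<in> ?A}" for d
      using that le by blast
  qed (use att finite_hamming_dists[OF fin] in simp_all)
  then show ?thesis
    unfolding anticode_def A_family_eq_line[OF tn k q1]
    using xA sub unfolding const_wt_words_def by blast
qed

theorem theorem10:
  fixes q k t :: nat
  assumes "q > 3" and "k > t"
  shows "\<exists>n0. \<forall>n\<ge>n0.
    anticode q n (2 * (k - t) - 1) k (A_family q t k n) \<and>
    (\<forall>B. anticode q n (2 * (k - t) - 1) k B \<longrightarrow> card B \<le> card (A_family q t k n)) \<and>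
    (\<forall>B. anticode q n (2 * (k - t) - 1) k B \<and> card B = card (A_family q t k n) \<longrightarrow>
       equivalent q n B (A_family q t k n))"
proof -
  have q: "q > 2" using assms(1) by simp
  have k: "t < k" using assms(2) .
  obtain n1 where n1: "\<And>n B. n \<ge> n1 \<Longrightarrow> B \<subseteq> const_wt_words q n k \<Longrightarrow> overlapping t B \<Longrightarrow>
    card B < (q - 1) * completion_count q n k (t + 1) \<or>
    (\<exists>T i w. T \<subseteq> {..<n} \<and> card T = t + 1 \<and> i \<in> T \<and> (\<forall>j\<in>T - {i}. w j \<in> {1..<q}) \<and>
       B \<subseteq> line q n k T i w {1..<q})"
    using overlapping_small_or_in_line[OF q k] by metis
  show ?thesis
  proof (intro exI allI impI)
    fix n assume n: "n \<ge> max n1 (t + 1 + 2 * (k - t - 1))"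
    then have tn: "t < n" by simp
    have cA: "card (A_family q t k n) = (q - 1) * completion_count q n k (t + 1)"
      using card_A_family[OF tn k] q by simp
    have main: "card B < card (A_family q t k n) \<or>
        card B \<le> card (A_family q t k n) \<and>
        (card B = card (A_family q t k n) \<longrightarrow> equivalent q n B (A_family q t k n))"
      if B: "anticode q n (2 * (k - t) - 1) k B" for B
    proof -
      have "B \<subseteq> const_wt_words q n k" "overlapping t B" using anticode_imp_overlapping[OF B k] by auto
      moreover have "n \<ge> n1" using n by simp
      ultimately have disj: "card B < card (A_family q t k n) \<or>
        (\<exists>T i w. T \<subseteq> {..<n} \<and> card T = t + 1 \<and> i \<in> T \<and> (\<forall>j\<in>T - {i}. w j \<in> {1..<q}) \<and>
           B \<subseteq> line q n k T i w {1..<q})"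
        using n1[of n B] unfolding cA by simp
      show ?thesis
      proof (cases "card B < card (A_family q t k n)")
        case False
        with disj obtain T i w where line: "T \<subseteq> {..<n}" "card T = t + 1" "i \<in> T"
            "\<forall>j\<in>T - {i}. w j \<in> {1..<q}" "B \<subseteq> line q n k T i w {1..<q}"
          by (elim disjE exE conjE) simp_all
        let ?L = "line q n k T i w {1..<q}"
        have fin: "finite ?L" by (rule finite_subset[OF _ finite_const_wt_words]) (auto simp: line_def)
        have cL: "card ?L = card (A_family q t k n)"
          using card_line[of T n i w q "{1..<q}" k] line q cA by simp
        have "equivalent q n ?L (A_family q t k n)"
          using line_equivalent_A_family[of T n t i w q k] line q k by simp
        moreover have "B = ?L" if "card B = card (A_family q t k n)"
          using card_subset_eq[OF fin line(5)] that cL by simp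
        ultimately show ?thesis using card_mono[OF fin line(5)] cL by auto
      qed simp
    qed
    show "anticode q n (2 * (k - t) - 1) k (A_family q t k n) \<and>
      (\<forall>B. anticode q n (2 * (k - t) - 1) k B \<longrightarrow> card B \<le> card (A_family q t k n)) \<and>
      (\<forall>B. anticode q n (2 * (k - t) - 1) k B \<and> card B = card (A_family q t k n) \<longrightarrow>
         equivalent q n B (A_family q t k n))"
    proof (intro conjI allI impI)
      show "anticode q n (2 * (k - t) - 1) k (A_family q t k n)"
        using anticode_A_family[OF q k] n by simp
    next
      fix B assume "anticode q n (2 * (k - t) - 1) k B"
      then show "card B \<le> card (A_family q t k n)" using main[of B] by linarith
    next
      fix B assume "anticode q n (2 * (k - t) - 1) k B \<and> card B = card (A_family q t k n)"
      then show "equivalent q n B (A_family q t k n)" using main[of B] by simp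
    qed
  qed
qed

end
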